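(* Let $G=(\mathcal{N},\{J^i\}_{i\in\mathcal{N}},\Gamma)$ be the dynamic game described in the context, with costs $J^i$ that decompose into private costs $L^{ii}_k$ and interagent costs $L^{ij}_k$. Suppose that: (1) (Dynamics) all agents have identical linear dynamics $x^i_{k+1}=Ax^i_k+Bu^i_k$ for all $i\in\mathcal{N}$, $k\in\{0,\dots,T-1\}$; (2) (Distance cost) $L^{ij}_k(x^i_k,x^j_k)=-\mu(\Vert x^i_k-x^j_k\Vert^2)$ for all $i\neq j$ in $\mathcal{N}$ and $k\in\{0,\dots,T\}$, where $\mu:\mathbb{R}_{\ge 0}\to\mathbb{R}$ is a monotonically increasing function (so that, with (1), $G$ is an exact dynamic potential game); (3) (Symmetric robustness) $\epsilon^{i,H}=\epsilon^{j,H}$ for all $i,j\in\mathcal{N}$ and all $H\in\{1,\dots,T\}$. Then the strategically robust game $\tilde G=(\mathcal{N},\{\tilde J^i\}_{i\in\mathcal{N}},\Gamma)$ is also an exact dynamic potential game, with potential function $$\tilde\Phi(x_0,\gamma(x_0))=\sum_{i\in\mathcal{N}}\Big[L^{ii}_T(x^i_T)+\sum_{k=0}^{T-1}L^{ii}_k(x^i_k,u^i_k)\Big]+\sum_{i,j\in\mathcal{N},\,i<j}\ \sum_{H=0}^{T}\tilde L^{ij}_H(x^i_H,x^j_H).$$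
   Context: Agents: $\mathcal{N}=\{1,\dots,N\}$; horizon $T\ge 1$. Agent $i$ has state $x^i_k\in\mathbb{R}^n$ ($0\le k\le T$) and input $u^i_k\in\mathbb{R}^m$ ($0\le k\le T-1$); $x_k,u_k$ are the concatenations over agents. $A\in\mathbb{R}^{n\times n}$, $B\in\mathbb{R}^{n\times m}$. $\Vert\cdot\Vert$ is the Euclidean norm. Strategies (open loop): given the initial state $x_0=(x_0^1,\dots,x_0^N)$, a strategy $\gamma^i\in\Gamma^i$ of agent $i$ specifies a control sequence $\gamma^i(x_0)=(u^i_0,\dots,u^i_{T-1})$, which generates the trajectory $x^i$ from $x^i_0$ via the dynamics. $\Gamma=\prod_{i\in\mathcal{N}}\Gamma^i$, $\gamma=(\gamma^1,\dots,\gamma^N)$, and $\gamma^{-i}$ denotes the strategies of all agents other than $i$. Nominal cost: $$J^i(x_0,\gamma(x_0))=L^i_T(x_T)+\sum_{k=0}^{T-1}L^i_k(x_k,u_k),$$ evaluated along the trajectories generated by $\gamma(x_0)$ from $x_0$, where $$L^i_k(x_k,u_k)=L^{ii}_k(x^i_k,u^i_k)+\sum_{j\in\mathcal{N}\setminus\{i\}}L^{ij}_k(x^i_k,x^j_k)\ (0\le k\le T-1),\qquad L^i_T(x_T)=L^{ii}_T(x^i_T)+\sum_{j\in\mathcal{N}\setminus\{i\}}L^{ij}_T(x^i_T,x^j_T).$$ All these cost functions are assumed continuously differentiable. Robust distance cost: the robustness levels are $\epsilon^{j,H}\ge 0$ for $j\in\mathcal{N}$, $H\in\{1,\dots,T\}$.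 For $i\ne j$ and $H\in\{1,\dots,T\}$, given the nominal inputs $u^j_0,\dots,u^j_{H-1}$ of agent $j$, $$\tilde L^{ij}_H(x^i_H,x^j_H)=\max_{\hat u_0,\dots,\hat u_{H-1}\in\mathbb{R}^m}L^{ij}_H(x^i_H,\hat x_H)\quad\text{s.t. } \hat x_0=x^j_0,\ \hat x_{k+1}=A\hat x_k+B\hat u_k\ (0\le k\le H-1),\ \sum_{k=0}^{H-1}\Vert u^j_k-\hat u_k\Vert^2\le(\epsilon^{j,H})^2.$$ For $H=0$, $\tilde L^{ij}_0=L^{ij}_0$. Strategically robust cost: $$\tilde J^i(x_0,\gamma(x_0))=L^{ii}_T(x^i_T)+\sum_{k=0}^{T-1}L^{ii}_k(x^i_k,u^i_k)+\sum_{j\in\mathcal{N}\setminus\{i\}}\sum_{H=0}^{T}\tilde L^{ij}_H(x^i_H,x^j_H).$$ Exact dynamic potential game: a game $(\mathcal{N},\{K^i\}_{i\in\mathcal{N}},\Gamma)$ is an exact dynamic potential game with potential function $\Phi(x_0,\gamma(x_0))$ if for every $i\in\mathcal{N}$, all $\gamma^i,\gamma^{i\prime}\in\Gamma^i$, all $\gamma^{-i}$, and every $x_0$, $$K^i(x_0,\{\gamma^i(x_0),\gamma^{-i}(x_0)\})-K^i(x_0,\{\gamma^{i\prime}(x_0),\gamma^{-i}(x_0)\})=\Phi(x_0,\{\gamma^i(x_0),\gamma^{-i}(x_0)\})-\Phi(x_0,\{\gamma^{i\prime}(x_0),\gamma^{-i}(x_0)\}).$$ *)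

theory Defs
  imports "HOL-Analysis.Analysis"
begin

(* Conventions used throughout.
   Agents are the elements of a finite linearly ordered type 'i, which stands for {1..N}.
   States live in real^'n and inputs in real^'m; both are normed by the Euclidean norm.
   A joint state is a function 'i => real^'n, a control sequence is a function nat => real^'m;
   only the entries 0..T-1 of a control sequence enter the costs. *)

definition continuously_differentiable ::
    "('a::real_normed_vector \<Rightarrow> 'b::real_normed_vector) \<Rightarrow> bool" where
  "continuously_differentiable g \<longleftrightarrow>
     (\<exists>g'. (\<forall>x. (g has_derivative blinfun_apply (g' x)) (at x)) \<and> continuous_on UNIV g')"

primrec trajectory :: "(nat \<Rightarrow> 's \<Rightarrow> 'u \<Rightarrow> 's) \<Rightarrow> 's \<Rightarrow> (nat \<Rightarrow> 'u) \<Rightarrow> nat \<Rightarrow> 's" where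
  "trajectory f x0 u 0 = x0"
| "trajectory f x0 u (Suc k) = f k (trajectory f x0 u k) (u k)"

abbreviation linear_dynamics ::
    "real^'n^'n \<Rightarrow> real^'m^'n \<Rightarrow> nat \<Rightarrow> real^'n \<Rightarrow> real^'m \<Rightarrow> real^'n" where
  "linear_dynamics A B \<equiv> (\<lambda>_ x u. A *v x + B *v u)"

text \<open>
  The cost data are \<open>Lpriv i k\<close> (the private cost of agent \<open>i\<close> at stage \<open>k < T\<close>), \<open>Lterm i\<close>
  (its private terminal cost) and \<open>Lint i j k\<close> (the interagent cost of \<open>i\<close> with respect to \<open>j\<close> at
  time \<open>k \<le> T\<close>; meaningful only for \<open>i \<noteq> j\<close>).
\<close>

definition stage_cost ::
    "('i::finite \<Rightarrow> nat \<Rightarrow> real^'n \<Rightarrow> real^'m \<Rightarrow> real) \<Rightarrow> ('i \<Rightarrow> 'i \<Rightarrow> nat \<Rightarrow> real^'n \<Rightarrow> real^'n \<Rightarrow> real) \<Rightarrow>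
     'i \<Rightarrow> nat \<Rightarrow> ('i \<Rightarrow> real^'n) \<Rightarrow> ('i \<Rightarrow> real^'m) \<Rightarrow> real" where
  "stage_cost Lpriv Lint i k x u = Lpriv i k (x i) (u i) + (\<Sum>j\<in>UNIV - {i}. Lint i j k (x i) (x j))"

definition terminal_cost ::
    "('i::finite \<Rightarrow> real^'n \<Rightarrow> real) \<Rightarrow> ('i \<Rightarrow> 'i \<Rightarrow> nat \<Rightarrow> real^'n \<Rightarrow> real^'n \<Rightarrow> real) \<Rightarrow>
     nat \<Rightarrow> 'i \<Rightarrow> ('i \<Rightarrow> real^'n) \<Rightarrow> real" where
  "terminal_cost Lterm Lint T i x = Lterm i (x i) + (\<Sum>j\<in>UNIV - {i}. Lint i j T (x i) (x j))"

definition nominal_cost ::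
    "('i::finite \<Rightarrow> nat \<Rightarrow> real^'n \<Rightarrow> real^'m \<Rightarrow> real^'n) \<Rightarrow>
     ('i \<Rightarrow> nat \<Rightarrow> real^'n \<Rightarrow> real^'m \<Rightarrow> real) \<Rightarrow> ('i \<Rightarrow> real^'n \<Rightarrow> real) \<Rightarrow>
     ('i \<Rightarrow> 'i \<Rightarrow> nat \<Rightarrow> real^'n \<Rightarrow> real^'n \<Rightarrow> real) \<Rightarrow> nat \<Rightarrow>
     'i \<Rightarrow> ('i \<Rightarrow> real^'n) \<Rightarrow> ('i \<Rightarrow> nat \<Rightarrow> real^'m) \<Rightarrow> real" where
  "nominal_cost f Lpriv Lterm Lint T i x0 u =
     (let x = (\<lambda>j. trajectory (f j) (x0 j) (u j)) in
        terminal_cost Lterm Lint T i (\<lambda>j. x j T)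
        + (\<Sum>k<T. stage_cost Lpriv Lint i k (\<lambda>j. x j k) (\<lambda>j. u j k)))"

text \<open>
  The worst case, seen from state \<open>xi\<close> of an agent at time \<open>H\<close>, of the distance cost \<open>L\<close> towards
  an opponent with initial state \<open>xj0\<close> and nominal inputs \<open>uj\<close>. Besides the nominal state of the
  opponent at time \<open>H\<close>, it depends on \<open>xj0\<close> and \<open>uj\<close>, which determine that state.
  The constraint on the perturbed states is expressed by \<open>trajectory\<close>. For continuous \<open>L\<close> the
  feasible set of \<open>(v 0, ..., v (H-1))\<close> is compact and nonempty, so the maximum is attained;
  \<open>GREATEST\<close> is then its value.
\<close>

definition robust_distance_cost ::
    "real^'n^'n \<Rightarrow> real^'m^'n \<Rightarrow> (real^'n \<Rightarrow> real^'n \<Rightarrow> real) \<Rightarrow> real \<Rightarrow> nat \<Rightarrow>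
     real^'n \<Rightarrow> real^'n \<Rightarrow> (nat \<Rightarrow> real^'m) \<Rightarrow> real" where
  "robust_distance_cost A B L \<epsilon> H xi xj0 uj =
     (if H = 0 then L xi xj0
      else (GREATEST c. \<exists>v. (\<Sum>k<H. (norm (uj k - v k))\<^sup>2) \<le> \<epsilon>\<^sup>2 \<and>
                            c = L xi (trajectory (linear_dynamics A B) xj0 v H)))"

definition private_cost ::
    "('i::finite \<Rightarrow> nat \<Rightarrow> real^'n \<Rightarrow> real^'m \<Rightarrow> real^'n) \<Rightarrow>
     ('i \<Rightarrow> nat \<Rightarrow> real^'n \<Rightarrow> real^'m \<Rightarrow> real) \<Rightarrow> ('i \<Rightarrow> real^'n \<Rightarrow> real) \<Rightarrow> nat \<Rightarrow>
     'i \<Rightarrow> ('i \<Rightarrow> real^'n) \<Rightarrow> ('i \<Rightarrow> nat \<Rightarrow> real^'m) \<Rightarrow> real" where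
  "private_cost f Lpriv Lterm T i x0 u =
     (let x = trajectory (f i) (x0 i) (u i) in
        Lterm i (x T) + (\<Sum>k<T. Lpriv i k (x k) (u i k)))"

definition robust_interagent_cost ::
    "('i::finite \<Rightarrow> nat \<Rightarrow> real^'n \<Rightarrow> real^'m \<Rightarrow> real^'n) \<Rightarrow> real^'n^'n \<Rightarrow> real^'m^'n \<Rightarrow>
     ('i \<Rightarrow> 'i \<Rightarrow> nat \<Rightarrow> real^'n \<Rightarrow> real^'n \<Rightarrow> real) \<Rightarrow> ('i \<Rightarrow> nat \<Rightarrow> real) \<Rightarrow>
     'i \<Rightarrow> 'i \<Rightarrow> nat \<Rightarrow> ('i \<Rightarrow> real^'n) \<Rightarrow> ('i \<Rightarrow> nat \<Rightarrow> real^'m) \<Rightarrow> real" where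
  "robust_interagent_cost f A B Lint \<epsilon> i j H x0 u =
     robust_distance_cost A B (Lint i j H) (\<epsilon> j H) H
       (trajectory (f i) (x0 i) (u i) H) (x0 j) (u j)"

definition robust_cost ::
    "('i::finite \<Rightarrow> nat \<Rightarrow> real^'n \<Rightarrow> real^'m \<Rightarrow> real^'n) \<Rightarrow> real^'n^'n \<Rightarrow> real^'m^'n \<Rightarrow>
     ('i \<Rightarrow> nat \<Rightarrow> real^'n \<Rightarrow> real^'m \<Rightarrow> real) \<Rightarrow> ('i \<Rightarrow> real^'n \<Rightarrow> real) \<Rightarrow>
     ('i \<Rightarrow> 'i \<Rightarrow> nat \<Rightarrow> real^'n \<Rightarrow> real^'n \<Rightarrow> real) \<Rightarrow> ('i \<Rightarrow> nat \<Rightarrow> real) \<Rightarrow> nat \<Rightarrow>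
     'i \<Rightarrow> ('i \<Rightarrow> real^'n) \<Rightarrow> ('i \<Rightarrow> nat \<Rightarrow> real^'m) \<Rightarrow> real" where
  "robust_cost f A B Lpriv Lterm Lint \<epsilon> T i x0 u =
     private_cost f Lpriv Lterm T i x0 u
     + (\<Sum>j\<in>UNIV - {i}. \<Sum>H\<le>T. robust_interagent_cost f A B Lint \<epsilon> i j H x0 u)"

definition robust_potential ::
    "('i::{finite,linorder} \<Rightarrow> nat \<Rightarrow> real^'n \<Rightarrow> real^'m \<Rightarrow> real^'n) \<Rightarrow> real^'n^'n \<Rightarrow> real^'m^'n \<Rightarrow>
     ('i \<Rightarrow> nat \<Rightarrow> real^'n \<Rightarrow> real^'m \<Rightarrow> real) \<Rightarrow> ('i \<Rightarrow> real^'n \<Rightarrow> real) \<Rightarrow>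
     ('i \<Rightarrow> 'i \<Rightarrow> nat \<Rightarrow> real^'n \<Rightarrow> real^'n \<Rightarrow> real) \<Rightarrow> ('i \<Rightarrow> nat \<Rightarrow> real) \<Rightarrow> nat \<Rightarrow>
     ('i \<Rightarrow> real^'n) \<Rightarrow> ('i \<Rightarrow> nat \<Rightarrow> real^'m) \<Rightarrow> real" where
  "robust_potential f A B Lpriv Lterm Lint \<epsilon> T x0 u =
     (\<Sum>i\<in>UNIV. private_cost f Lpriv Lterm T i x0 u)
     + (\<Sum>(i, j)\<in>{(i, j). i < j}. \<Sum>H\<le>T. robust_interagent_cost f A B Lint \<epsilon> i j H x0 u)"

text \<open>
  An open-loop strategy maps the joint initial state to a control sequence. \<open>\<Gamma> i\<close> is the strategy
  set of agent \<open>i\<close>; \<open>\<gamma>(i := \<gamma>i)\<close> is the profile in which \<open>i\<close> plays \<open>\<gamma>i\<close> and the others follow \<open>\<gamma>\<close>.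
\<close>

definition control_profile :: "('i \<Rightarrow> 'x \<Rightarrow> nat \<Rightarrow> 'u) \<Rightarrow> 'x \<Rightarrow> 'i \<Rightarrow> nat \<Rightarrow> 'u" where
  "control_profile \<gamma> x0 = (\<lambda>i. \<gamma> i x0)"

definition exact_dynamic_potential_game ::
    "('i \<Rightarrow> 'x \<Rightarrow> ('i \<Rightarrow> nat \<Rightarrow> 'u) \<Rightarrow> real) \<Rightarrow> ('i \<Rightarrow> ('x \<Rightarrow> nat \<Rightarrow> 'u) set) \<Rightarrow>
     ('x \<Rightarrow> ('i \<Rightarrow> nat \<Rightarrow> 'u) \<Rightarrow> real) \<Rightarrow> bool" where
  "exact_dynamic_potential_game K \<Gamma> \<Phi> \<longleftrightarrow>
     (\<forall>i. \<forall>\<gamma>i\<in>\<Gamma> i. \<forall>\<gamma>i'\<in>\<Gamma> i. \<forall>\<gamma>\<in>Pi UNIV \<Gamma>. \<forall>x0.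
        K i x0 (control_profile (\<gamma>(i := \<gamma>i)) x0) - K i x0 (control_profile (\<gamma>(i := \<gamma>i')) x0) =
        \<Phi> x0 (control_profile (\<gamma>(i := \<gamma>i)) x0) - \<Phi> x0 (control_profile (\<gamma>(i := \<gamma>i')) x0))"

end

theory Submission
  imports Defs
begin

text \<open>
  With identical linear dynamics the reflection \<open>v \<mapsto> ui + uj - v\<close> maps the perturbations of \<open>uj\<close>
  onto the equally large perturbations of \<open>ui\<close>, and by superposition it turns the distance of \<open>i\<close>
  from the perturbed \<open>j\<close> into the distance of \<open>j\<close> from the perturbed \<open>i\<close>. So the two worst cases
  optimise over the same set of values, the robust interagent costs are symmetric, and any game
  with symmetric pairwise costs is an exact potential game. Attainment of the maximum plays no role.
\<close>

text \<open>Every pair containing \<open>i\<close> contributes to \<open>\<Phi>\<close> exactly one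
  interaction term of \<open>K i\<close>, so \<open>\<Phi>\<close> and \<open>K i\<close> differ by
  a quantity in which agent \<open>i\<close> does not occur, and this cancels under a deviation of
  \<open>i\<close>. For this, \<open>P\<close> and \<open>W\<close> receive only the control
  sequences of the agents they concern.\<close>

lemma exact_dynamic_potential_game_pairwise:
  fixes K :: "'i::{finite,linorder} \<Rightarrow> 'x \<Rightarrow> ('i \<Rightarrow> nat \<Rightarrow> 'u) \<Rightarrow> real"
  assumes K: "\<And>i x0 u. K i x0 u = P i x0 (u i) + (\<Sum>j\<in>UNIV - {i}. W i j x0 (u i) (u j))"
    and \<Phi>: "\<And>x0 u. \<Phi> x0 u =
      (\<Sum>i\<in>UNIV. P i x0 (u i)) + (\<Sum>(i, j)\<in>{(i, j). i < j}. W i j x0 (u i) (u j))"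
    and sym: "\<And>i j x0 a b. i \<noteq> j \<Longrightarrow> W i j x0 a b = W j i x0 b a"
  shows "exact_dynamic_potential_game K \<Gamma> \<Phi>"
proof -
  define R where "R i x0 u = (\<Sum>j\<in>UNIV - {i}. P j x0 (u j)) +
    (\<Sum>(a, b)\<in>{(a, b). a < b \<and> a \<noteq> i \<and> b \<noteq> i}. W a b x0 (u a) (u b))" for i x0 u
  have split: "\<Phi> x0 u = K i x0 u + R i x0 u" for i x0 u
  proof -
    let ?w = "\<lambda>(a, b). W a b x0 (u a) (u b)"
    let ?out = "{(a, b). a < b \<and> a \<noteq> i \<and> b \<noteq> i}"
    let ?in = "{(a, b). a < b \<and> (a = i \<or> b = i)}"
    have pairs: "{(a, b). a < b} = ?in \<union> ?out"
      by auto
    have "sum ?w {(a, b). a < b} = sum ?w ?in + sum ?w ?out"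
      unfolding pairs by (rule sum.union_disjoint) auto
    \<comment> \<open>Each opponent \<open>j\<close> corresponds to the sorted pair of
      \<open>i\<close> and \<open>j\<close>; the inverse picks the entry other than
      \<open>i\<close>. Symmetry is used when \<open>i\<close> is the larger entry.\<close>
    moreover have "sum ?w ?in = (\<Sum>j\<in>UNIV - {i}. W i j x0 (u i) (u j))"
      by (rule sum.reindex_bij_witness
            [where i = "\<lambda>j. (min i j, max i j)" and j = "\<lambda>(a, b). if a = i then b else a"])
        (auto simp: min_def max_def split: if_splits intro: sym)
    moreover have "(\<Sum>j\<in>UNIV. P j x0 (u j)) = P i x0 (u i) + (\<Sum>j\<in>UNIV - {i}. P j x0 (u j))"
      by (rule sum.remove) auto
    ultimately show ?thesis
      by (simp add: \<Phi> K R_def)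
  qed
  have R_upd: "R i x0 (control_profile (\<gamma>(i := g)) x0) = R i x0 (control_profile \<gamma> x0)" for i x0 \<gamma> g
    unfolding R_def control_profile_def by (intro arg_cong2[where f = "(+)"] sum.cong) auto
  show ?thesis
    unfolding exact_dynamic_potential_game_def
  proof (intro allI ballI)
    fix i gi gi' \<gamma> x0
    show "K i x0 (control_profile (\<gamma>(i := gi)) x0) - K i x0 (control_profile (\<gamma>(i := gi')) x0) =
        \<Phi> x0 (control_profile (\<gamma>(i := gi)) x0) - \<Phi> x0 (control_profile (\<gamma>(i := gi')) x0)"
      by (simp add: split[where i = i] R_upd)
  qed
qed

lemma trajectory_cong:
  assumes "\<And>k x u. k < T \<Longrightarrow> f k x u = g k x u" and "H \<le> T"
  shows "trajectory f x0 u H = trajectory g x0 u H"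
  using assms(2) by (induction H) (auto simp: assms(1))

text \<open>The sum of two trajectories follows the same linear recursion, driven by the sum of the
  inputs and started at \<open>x + y\<close>. The induction therefore runs on the sum; the
  individual trajectories may differ.\<close>

lemma trajectory_linear_superposition:
  assumes "\<And>k. v k + w k = u k + u' k"
  shows "trajectory (linear_dynamics A B) x v H + trajectory (linear_dynamics A B) y w H =
    trajectory (linear_dynamics A B) x u H + trajectory (linear_dynamics A B) y u' H"
proof (induction H)
  case (Suc H)
  let ?t = "trajectory (linear_dynamics A B)"
  have "A *v (?t x v H + ?t y w H) + B *v (v H + w H) =
      A *v (?t x u H + ?t y u' H) + B *v (u H + u' H)"
    by (simp only: Suc assms)
  then show ?case
    by (simp add: matrix_vector_right_distrib ac_simps)
qed simp

text \<open>\<open>L\<close> and \<open>L'\<close> are kept apart because they stand for the costs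
  of \<open>i\<close> towards \<open>j\<close> and of \<open>j\<close> towards \<open>i\<close>, two
  functions that agree only through the distance.\<close>

lemma robust_distance_cost_symmetric:
  fixes A :: "real^'n^'n" and B :: "real^'m^'n" and d :: "real \<Rightarrow> real"
  assumes L: "\<And>x y. L x y = d (norm (x - y))" and L': "\<And>x y. L' x y = d (norm (x - y))"
  defines "tr \<equiv> trajectory (linear_dynamics A B)"
  shows "robust_distance_cost A B L e H (tr xi ui H) xj uj =
    robust_distance_cost A B L' e H (tr xj uj H) xi ui"
proof -
  \<comment> \<open>Stated for arbitrary states and inputs, so that exchanging the two agents gives
    the converse inclusion as well.\<close>
  have reflect: "\<exists>v'. (\<Sum>k<H. (norm (ui k - v' k))\<^sup>2) \<le> e\<^sup>2 \<and>
      c = d (norm (tr xj uj H - tr xi v' H))"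
    if v: "(\<Sum>k<H. (norm (uj k - v k))\<^sup>2) \<le> e\<^sup>2" and c: "c = d (norm (tr xi ui H - tr xj v H))"
    for c xi xj v and ui uj :: "nat \<Rightarrow> real^'m"
  proof (intro exI conjI)
    let ?v' = "\<lambda>k. ui k + uj k - v k"
    show "(\<Sum>k<H. (norm (ui k - ?v' k))\<^sup>2) \<le> e\<^sup>2"
      using v by (simp add: norm_minus_commute)
    have "tr xi ?v' H + tr xj v H = tr xi ui H + tr xj uj H"
      unfolding tr_def by (rule trajectory_linear_superposition) simp
    then have "tr xj uj H - tr xi ?v' H = - (tr xi ui H - tr xj v H)"
      by (simp add: algebra_simps)
    then show "c = d (norm (tr xj uj H - tr xi ?v' H))"
      using c by (metis norm_minus_cancel)
  qed
  have "(\<exists>v. (\<Sum>k<H. (norm (uj k - v k))\<^sup>2) \<le> e\<^sup>2 \<and> c = d (norm (tr xi ui H - tr xj v H))) \<longleftrightarrow>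
      (\<exists>v. (\<Sum>k<H. (norm (ui k - v k))\<^sup>2) \<le> e\<^sup>2 \<and> c = d (norm (tr xj uj H - tr xi v H)))" for c
    by (rule iffI; elim exE conjE; erule (1) reflect)
  then show ?thesis
    by (simp add: robust_distance_cost_def L L' norm_minus_commute tr_def)
qed

theorem theorem1:
  fixes T :: nat
    and A :: "real^'n^'n" and B :: "real^'m^'n"
    and f :: "'i::{finite,linorder} \<Rightarrow> nat \<Rightarrow> real^'n \<Rightarrow> real^'m \<Rightarrow> real^'n"
    and Lpriv :: "'i \<Rightarrow> nat \<Rightarrow> real^'n \<Rightarrow> real^'m \<Rightarrow> real"
    and Lterm :: "'i \<Rightarrow> real^'n \<Rightarrow> real"
    and Lint :: "'i \<Rightarrow> 'i \<Rightarrow> nat \<Rightarrow> real^'n \<Rightarrow> real^'n \<Rightarrow> real"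
    and \<Gamma> :: "'i \<Rightarrow> (('i \<Rightarrow> real^'n) \<Rightarrow> nat \<Rightarrow> real^'m) set"
    and \<epsilon> :: "'i \<Rightarrow> nat \<Rightarrow> real"
    and \<mu> :: "real \<Rightarrow> real"
  assumes T: "T \<ge> 1"
    and Lpriv_C1: "\<And>i k. k < T \<Longrightarrow> continuously_differentiable (\<lambda>(x, u). Lpriv i k x u)"
    and Lterm_C1: "\<And>i. continuously_differentiable (Lterm i)"
    and Lint_C1: "\<And>i j k. i \<noteq> j \<Longrightarrow> k \<le> T \<Longrightarrow> continuously_differentiable (\<lambda>(x, y). Lint i j k x y)"
    and \<epsilon>_nonneg: "\<And>j H. 1 \<le> H \<Longrightarrow> H \<le> T \<Longrightarrow> \<epsilon> j H \<ge> 0"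
    and dynamics: "\<And>i k x u. k < T \<Longrightarrow> f i k x u = A *v x + B *v u"
    and mu_mono: "mono_on {0..} \<mu>"
    and distance_cost: "\<And>i j k x y. i \<noteq> j \<Longrightarrow> k \<le> T \<Longrightarrow> Lint i j k x y = - \<mu> ((norm (x - y))\<^sup>2)"
    and symmetric_robustness: "\<And>i j H. 1 \<le> H \<Longrightarrow> H \<le> T \<Longrightarrow> \<epsilon> i H = \<epsilon> j H"
  shows "(\<exists>\<Phi>. exact_dynamic_potential_game (nominal_cost f Lpriv Lterm Lint T) \<Gamma> \<Phi>) \<and>
         exact_dynamic_potential_game (robust_cost f A B Lpriv Lterm Lint \<epsilon> T) \<Gamma>
           (robust_potential f A B Lpriv Lterm Lint \<epsilon> T)"
proof
  let ?x = "\<lambda>i x0 u. trajectory (f i) (x0 i) u"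
  let ?P = "\<lambda>i x0 u. Lterm i (?x i x0 u T) + (\<Sum>k<T. Lpriv i k (?x i x0 u k) (u k))"
  let ?W = "\<lambda>i j x0 a b. \<Sum>H\<le>T. Lint i j H (?x i x0 a H) (?x j x0 b H)"
  show "\<exists>\<Phi>. exact_dynamic_potential_game (nominal_cost f Lpriv Lterm Lint T) \<Gamma> \<Phi>"
  proof (intro exI exact_dynamic_potential_game_pairwise[where P = ?P and W = ?W])
    fix i x0 u
    \<comment> \<open>Costs are grouped by time in \<open>nominal_cost\<close> but by opponent in
      \<open>?W\<close>; the summand \<open>H = T\<close> is the interagent part of the terminal
      cost.\<close>
    have "(\<Sum>j\<in>UNIV - {i}. ?W i j x0 (u i) (u j)) =
        (\<Sum>H\<le>T. \<Sum>j\<in>UNIV - {i}. Lint i j H (?x i x0 (u i) H) (?x j x0 (u j) H))"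
      by (rule sum.swap)
    then show "nominal_cost f Lpriv Lterm Lint T i x0 u =
        ?P i x0 (u i) + (\<Sum>j\<in>UNIV - {i}. ?W i j x0 (u i) (u j))"
      by (simp add: nominal_cost_def stage_cost_def terminal_cost_def Let_def sum.distrib
            lessThan_Suc_atMost[symmetric])
  next
    fix i j :: 'i and x0 a b
    assume "i \<noteq> j"
    then show "?W i j x0 a b = ?W j i x0 b a"
      by (intro sum.cong) (auto simp: distance_cost norm_minus_commute)
  qed (rule refl)

  let ?R = "\<lambda>i j x0 a b. \<Sum>H\<le>T. robust_distance_cost A B (Lint i j H) (\<epsilon> j H) H (?x i x0 a H) (x0 j) b"
  show "exact_dynamic_potential_game (robust_cost f A B Lpriv Lterm Lint \<epsilon> T) \<Gamma>
      (robust_potential f A B Lpriv Lterm Lint \<epsilon> T)"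
  proof (rule exact_dynamic_potential_game_pairwise[where P = ?P and W = ?R])
    fix i j :: 'i and x0 a b
    assume ij: "i \<noteq> j"
    have "robust_distance_cost A B (Lint i j H) (\<epsilon> j H) H (?x i x0 a H) (x0 j) b =
        robust_distance_cost A B (Lint j i H) (\<epsilon> i H) H (?x j x0 b H) (x0 i) a" if H: "H \<le> T" for H
    \<comment> \<open>The robustness levels are only assumed equal from \<open>H = 1\<close> on; at
      \<open>H = 0\<close> the cost is the nominal one, without any level.\<close>
    proof (cases "H = 0")
      case True
      with ij show ?thesis
        by (simp add: robust_distance_cost_def distance_cost norm_minus_commute)
    next
      case False
      then have eps: "\<epsilon> j H = \<epsilon> i H"
        using H by (intro symmetric_robustness) simp_all
      \<comment> \<open>\<open>f\<close> is known to be linear only before time \<open>T\<close>,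
        which determines the states up to \<open>H \<le> T\<close>.\<close>
      have lin: "?x l x0 c H = trajectory (linear_dynamics A B) (x0 l) c H" for l c
        using H by (intro trajectory_cong[where T = T]) (simp_all add: dynamics)
      show ?thesis
        unfolding lin eps
        by (rule robust_distance_cost_symmetric[where d = "\<lambda>r. - \<mu> (r\<^sup>2)"])
          (use ij H in \<open>simp_all add: distance_cost\<close>)
    qed
    then show "?R i j x0 a b = ?R j i x0 b a"
      by (intro sum.cong) auto
  qed (simp_all add: robust_cost_def robust_potential_def private_cost_def
      robust_interagent_cost_def Let_def)
qed

end
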